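(* Let $f=\sum_{i=1}^{t}a_{i}x^{\alpha_{i}}y^{\beta_{i}}\in\mathbb{R}[x,y]$ be a polynomial with at most $t$ non-zero terms, and let $a,b\in\mathbb{R}$. Set $g(x)=f(x,ax+b)\in\mathbb{R}[x]$. Then either $g$ is identically zero or $g$ has at most $6t-4$ real roots, counted with multiplicities except for the possible roots $0$ and $-b/a$, which are counted at most once.
   Context: The exponents $\alpha_i,\beta_i$ are non-negative integers. "Counted at most once" means that if $0$ (respectively $-b/a$) is a root of $g$, it contributes $1$ to the count regardless of its multiplicity; every other real root contributes its multiplicity. When $a=0$ the point $-b/a$ does not exist, and only the root $0$ is exempted from counting with multiplicity. *)

theory Defs
  imports "HOL-Computational_Algebra.Polynomial"
begin

text \<open>
  The ring of real polynomials in \<open>x\<close> and \<open>y\<close> is represented as the type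
  \<^typ>\<open>real poly poly\<close> of polynomials in \<open>y\<close> whose coefficients are polynomials in \<open>x\<close>.
\<close>

definition bimonom :: "real \<Rightarrow> nat \<Rightarrow> nat \<Rightarrow> real poly poly"
  \<comment> \<open>the term \<open>c * x ^ m * y ^ n\<close>\<close>
  where "bimonom c m n = monom (monom c m) n"

text \<open>
  Evaluating the outer variable \<open>y\<close> at the polynomial \<open>a * x + b\<close> leaves \<open>x\<close> in place.
\<close>

definition restrict_line :: "real poly poly \<Rightarrow> real \<Rightarrow> real \<Rightarrow> real poly"
  where "restrict_line f a b = poly f [:b, a:]"

text \<open>
  Meaningful for \<open>g \<noteq> 0\<close> only: then the set of roots is finite, and \<^term>\<open>order r g\<close>
  is the multiplicity of the root \<open>r\<close>.
\<close>

definition count_roots_except :: "real set \<Rightarrow> real poly \<Rightarrow> nat"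
  where "count_roots_except E g =
    (\<Sum>r\<in>{r. poly g r = 0}. if r \<in> E then 1 else order r g)"

definition exempt_points :: "real \<Rightarrow> real \<Rightarrow> real set"
  where "exempt_points a b = (if a = 0 then {0} else {0, - b / a})"

end

theory Submission
  imports Defs
begin

text \<open>
  If the coefficient sequence of a real polynomial changes sign \<open>n\<close> times, then after
  multiplication by \<open>X + 1\<close> there are at most \<open>n\<close> sign changes, after multiplication by \<open>X - r\<close>
  with \<open>r > 0\<close> at least \<open>n + 1\<close>, and after adding a monomial at most \<open>n + 2\<close>. Peeling off the
  smallest power of \<open>X + 1\<close> over and over, a nonzero sum of \<open>t\<close> terms \<open>c X\<^sup>A (X + 1)\<^sup>B\<close> has
  at most \<open>2 t - 2\<close> sign changes, hence at most \<open>2 t - 2\<close> positive roots with multiplicity.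
  For \<open>a, b \<noteq> 0\<close> and \<open>k = b / a\<close>, the substitutions \<open>x = k v\<close>, \<open>x = - k (1 + v)\<close> and
  \<open>x = - k v / (1 + v)\<close> with \<open>v > 0\<close> bring \<open>g\<close> into this form and cover the line except for
  \<open>0\<close> and \<open>- k\<close>, so there are at most \<open>3 (2 t - 2) + 2\<close> roots. If \<open>a = 0\<close> or \<open>b = 0\<close>, then
  \<open>g\<close> is a sum of \<open>t\<close> monomials, and \<open>x = v\<close> and \<open>x = - v\<close> suffice.
\<close>

section \<open>Upper bounds for coefficient sign changes\<close>

text \<open>Means at least \<open>n\<close> sign changes, zeros being skipped. The encoding by
  witnesses reduces each estimate to moving indices; \<open>\<sigma>\<close> carries the sign of the
  first chosen coefficient.\<close>

definition alternates :: "real poly \<Rightarrow> nat \<Rightarrow> bool" where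
  "alternates p n \<longleftrightarrow> (\<exists>\<sigma> idx. (\<forall>j<n. idx j < idx (Suc j)) \<and>
     (\<forall>j\<le>n. 0 < \<sigma> * (-1) ^ j * coeff p (idx j)))"

lemma alternates_0: "p \<noteq> 0 \<Longrightarrow> alternates p 0"
  unfolding alternates_def
  by (intro exI[of _ "lead_coeff p"] exI[of _ "\<lambda>_. degree p"]) (simp flip: power2_eq_square)

lemma alternates_mono: "alternates p n \<Longrightarrow> m \<le> n \<Longrightarrow> alternates p m"
  unfolding alternates_def by (elim ex_forward conjE, intro conjI) auto

lemma alternates_monom: "\<not> alternates (monom c k) (Suc 0)"
proof
  assume "alternates (monom c k) (Suc 0)"
  then obtain \<sigma> :: real and idx where "idx 0 < idx (Suc 0)"
    "\<And>j. j \<le> Suc 0 \<Longrightarrow> 0 < \<sigma> * (-1) ^ j * coeff (monom c k) (idx j)"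
    unfolding alternates_def by blast
  from this(1) this(2)[of 0] this(2)[of "Suc 0"] show False
    by (auto split: if_splits)
qed

lemma coeff_linear_mult:
  "coeff ([:u, 1:] * p) i = u * coeff p i + (case i of 0 \<Rightarrow> 0 | Suc k \<Rightarrow> coeff (p :: real poly) k)"
  by (simp add: coeff_pCons split: nat.split)

text \<open>
  A coefficient of the product is \<open>p\<^sub>i + p\<^sub>i\<^sub>-\<^sub>1\<close>, so one of the two summands has its sign.
\<close>
lemma alternates_linear_plus_mult:
  assumes "alternates ([:1, 1:] * p) n"
  shows "alternates p n"
proof -
  obtain \<sigma> :: real and idx where
    idx: "\<And>j. j < n \<Longrightarrow> idx j < idx (Suc j)" and
    pos: "\<And>j. j \<le> n \<Longrightarrow> 0 < \<sigma> * (-1) ^ j * coeff ([:1, 1:] * p) (idx j)"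
    using assms unfolding alternates_def by blast
  have "\<exists>i. i \<le> idx j \<and> idx j \<le> Suc i \<and> 0 < \<sigma> * (-1) ^ j * coeff p i" if "j \<le> n" for j
  proof (cases "0 < \<sigma> * (-1) ^ j * coeff p (idx j)")
    case False
    with pos[OF that] obtain k where "idx j = Suc k"
      "0 < \<sigma> * (-1) ^ j * coeff p (Suc k) + \<sigma> * (-1) ^ j * coeff p k"
      unfolding coeff_linear_mult by (auto simp: distrib_left split: nat.splits)
    with False show ?thesis
      by (intro exI[of _ k]) simp
  qed auto
  then obtain h where h: "\<And>j. j \<le> n \<Longrightarrow> h j \<le> idx j \<and> idx j \<le> Suc (h j) \<and>
      0 < \<sigma> * (-1) ^ j * coeff p (h j)"
    by metis
  \<comment> \<open>The windows from \<open>idx j - 1\<close> to \<open>idx j\<close> overlap in at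
    most an endpoint, and opposite signs forbid a common choice there.\<close>
  have "h j < h (Suc j)" if "j < n" for j
  proof -
    have "h j \<noteq> h (Suc j)"
      using h[of j] h[of "Suc j"] that by auto
    with h[of j] h[of "Suc j"] idx[OF that] that show ?thesis by simp
  qed
  with h show ?thesis unfolding alternates_def by blast
qed

lemma alternates_linear_plus_power_mult:
  "alternates ([:1, 1:] ^ m * p) n \<Longrightarrow> alternates p n"
  by (induction m) (auto intro: alternates_linear_plus_mult simp: mult.assoc simp del: mult_pCons_left)

text \<open>Only the coefficient at \<open>k\<close> differs, so at most one chosen index is
  spoiled. Dropping it together with a neighbour preserves the parity of the later
  positions.\<close>

lemma alternates_add_monom:
  assumes "alternates (monom c k + p) (n + 2)"
  shows "alternates p n"
proof -
  obtain \<sigma> :: real and idx where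
    idx: "\<And>j. j < n + 2 \<Longrightarrow> idx j < idx (Suc j)" and
    pos: "\<And>j. j \<le> n + 2 \<Longrightarrow> 0 < \<sigma> * (-1) ^ j * coeff (monom c k + p) (idx j)"
    using assms unfolding alternates_def by blast
  have mono: "idx i < idx j" if "i < j" "j \<le> n + 2" for i j
    using that
  proof (induction j)
    case (Suc j)
    then show ?case
      using idx[of j] by (cases "i = j") auto
  qed simp
  \<comment> \<open>The default \<open>n + 3\<close> lies beyond all positions, so that
    \<open>h\<close> below skips nothing when \<open>k\<close> is not among the indices.\<close>
  define j0 where "j0 = (if \<exists>j\<le>n+2. idx j = k then SOME j. j \<le> n + 2 \<and> idx j = k else n + 3)"
  have j0: "idx j \<noteq> k" if "j \<noteq> j0" "j \<le> n + 2" for j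
  proof
    assume *: "idx j = k"
    then have "j0 \<le> n + 2 \<and> idx j0 = k"
      unfolding j0_def using that(2) someI[of "\<lambda>j. j \<le> n + 2 \<and> idx j = k" j] by auto
    with * that mono[of j j0] mono[of j0 j] show False
      by (metis less_irrefl nat_neq_iff)
  qed
  define h where "h j = (if j < j0 then idx j else idx (j + 2))" for j
  have "h j < h (Suc j)" if "j < n" for j
    using that by (auto simp: h_def intro!: mono)
  moreover have "0 < \<sigma> * (-1) ^ j * coeff p (h j)" if "j \<le> n" for j
    using that pos[of j] pos[of "j + 2"] j0[of j] j0[of "j + 2"] by (auto simp: h_def)
  ultimately show ?thesis unfolding alternates_def by blast
qed

lemma alternates_lacunary:
  fixes c :: "'i \<Rightarrow> real" and A B :: "'i \<Rightarrow> nat"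
  assumes "finite I"
  shows "\<not> alternates (\<Sum>i\<in>I. monom (c i) (A i) * [:1, 1:] ^ B i) (2 * card I - 1) \<or> I = {}"
proof -
  \<comment> \<open>The shift \<open>m\<close> lets the induction hypothesis be applied after a
    common power of \<open>X + 1\<close> has been divided out.\<close>
  have "\<forall>m. (\<forall>i\<in>I. m \<le> B i) \<longrightarrow>
      \<not> alternates (\<Sum>i\<in>I. monom (c i) (A i) * [:1, 1:] ^ (B i - m)) (2 * card I - 1) \<or> I = {}"
    using assms
  \<comment> \<open>By the negated ranking, the inserted \<open>x\<close> has the smallest exponent
    \<open>B x\<close>, so the remaining terms stay polynomials after division by that
    power.\<close>
  proof (induction rule: finite_ranking_induct[where f = "\<lambda>i. - int (B i)"])
    case (insert x S)
    show ?case
    proof (intro allI impI disjI1 notI)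
      fix m
      assume m: "\<forall>i\<in>insert x S. m \<le> B i"
      show False if alt: "alternates (\<Sum>i\<in>insert x S. monom (c i) (A i) * [:1, 1:] ^ (B i - m))
                      (2 * card (insert x S) - 1)"
      proof (cases "x \<in> S")
        case True
        with insert.IH m alt show False by (auto simp: insert_absorb)
      next
        case False
        let ?q = "\<Sum>i\<in>S. monom (c i) (A i) * [:1, 1:] ^ (B i - B x)"
        have "B i - m = (B x - m) + (B i - B x)" if "i \<in> S" for i
          using insert.hyps(2)[OF that] m by auto
        then have "(\<Sum>i\<in>S. monom (c i) (A i) * [:1, 1:] ^ (B i - m)) = [:1, 1:] ^ (B x - m) * ?q"
          unfolding sum_distrib_left
          by (intro sum.cong refl) (simp only: power_add mult_ac)
        then have "(\<Sum>i\<in>insert x S. monom (c i) (A i) * [:1, 1:] ^ (B i - m)) =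
            [:1, 1:] ^ (B x - m) * (monom (c x) (A x) + ?q)"
          using False insert.hyps(1) by (simp add: algebra_simps)
        with alt False insert.hyps(1)
        have *: "alternates (monom (c x) (A x) + ?q) (Suc (2 * card S))"
          by (auto intro: alternates_linear_plus_power_mult)
        show False
        proof (cases "S = {}")
          case True
          with * show False by (simp add: alternates_monom)
        next
          case nonempty: False
          then have "Suc (2 * card S) = (2 * card S - 1) + 2"
            using insert.hyps(1) by (cases "card S") auto
          with * have "alternates ?q (2 * card S - 1)"
            using alternates_add_monom by metis
          with insert.IH insert.hyps(2) nonempty show False by force
        qed
      qed
    qed
  qed simp
  from spec[OF this, of 0] show ?thesis by simp
qed

section \<open>Descartes' rule of signs\<close>

text \<open>The product has coefficients \<open>p_(i-1) - r p_i\<close>. Wherever \<open>p\<close>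
  loses a sign, the product has that sign; this happens after each of the \<open>n + 1\<close>
  chosen indices. One more coefficient, of opposite sign, comes from the start of the
  sequence.\<close>

lemma alternates_linear_minus_mult:
  assumes "alternates p n" "r > 0"
  shows "alternates ([:- r, 1:] * p) (Suc n)"
proof -
  let ?q = "[:- r, 1:] * p"
  obtain \<sigma> :: real and idx where
    idx: "\<And>j. j < n \<Longrightarrow> idx j < idx (Suc j)" and
    pos: "\<And>j. j \<le> n \<Longrightarrow> 0 < \<sigma> * (-1) ^ j * coeff p (idx j)"
    using assms(1) unfolding alternates_def by blast
  \<comment> \<open>At the first index where \<open>p\<close> has sign \<open>s\<close>, the
    preceding coefficient, if any, cannot outweigh \<open>- r p_i\<close>.\<close>
  have first: "\<exists>i\<le>m. s * coeff ?q i < 0" if "0 < s * coeff p m" for s m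
  proof -
    define i where "i = (LEAST i. 0 < s * coeff p i)"
    have i: "0 < s * coeff p i" "i \<le> m"
      unfolding i_def using that by (auto intro: LeastI Least_le)
    have "s * coeff p k \<le> 0" if "k < i" for k
      using not_less_Least[of k "\<lambda>i. 0 < s * coeff p i"] that unfolding i_def by auto
    moreover have "0 < r * (s * coeff p i)"
      using i assms by simp
    ultimately have "s * coeff ?q i < 0"
      unfolding coeff_linear_mult by (fastforce simp: algebra_simps split: nat.split)
    with i show ?thesis by blast
  qed
  \<comment> \<open>At the first index past \<open>m\<close> where sign \<open>s\<close> is lost,
    the preceding coefficient still has it.\<close>
  have cross: "\<exists>i. m < i \<and> i \<le> l \<and> 0 < s * coeff ?q i"
    if "0 < s * coeff p m" "m < l" "s * coeff p l \<le> 0" for s m l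
  proof -
    define i where "i = (LEAST i. m < i \<and> s * coeff p i \<le> 0)"
    have i: "m < i \<and> s * coeff p i \<le> 0" "i \<le> l"
      unfolding i_def using that by (auto intro: Least_le LeastI2)
    then obtain k where k: "i = Suc k" by (cases i) auto
    have "0 < s * coeff p k"
      using not_less_Least[of k "\<lambda>i. m < i \<and> s * coeff p i \<le> 0"] i(1) that(1) k
      unfolding i_def[symmetric] by (cases "k = m") auto
    moreover have "r * (s * coeff p i) \<le> 0"
      using i assms by (simp add: mult_nonneg_nonpos)
    ultimately have "0 < s * coeff ?q i"
      unfolding coeff_linear_mult k by (simp add: algebra_simps)
    with i show ?thesis by blast
  qed
  \<comment> \<open>The extra index exceeds \<open>degree p\<close>; the zero coefficient there ends
    the last run of signs.\<close>
  define e where "e j = (if j \<le> n then idx j else Suc (idx n + degree p))" for j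
  have "\<exists>i. e j < i \<and> i \<le> e (Suc j) \<and> 0 < \<sigma> * (-1) ^ j * coeff ?q i" if "j \<le> n" for j
  proof (rule cross)
    show "0 < \<sigma> * (-1) ^ j * coeff p (e j)"
      using pos that by (simp add: e_def)
    show "e j < e (Suc j)"
      using idx that by (cases "j = n") (auto simp: e_def)
    show "\<sigma> * (-1) ^ j * coeff p (e (Suc j)) \<le> 0"
      using pos[of "Suc j"] by (auto simp: e_def coeff_eq_0)
  qed
  then obtain h where h: "\<And>j. j \<le> n \<Longrightarrow> e j < h j \<and> h j \<le> e (Suc j) \<and>
      0 < \<sigma> * (-1) ^ j * coeff ?q (h j)"
    by metis
  obtain i0 where i0: "i0 \<le> idx 0" "\<sigma> * coeff ?q i0 < 0"
    using first[of \<sigma> "idx 0"] pos[of 0] by auto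
  \<comment> \<open>Prepending \<open>i0\<close> shifts all parities by one, hence the witness
    \<open>- \<sigma>\<close> below.\<close>
  define h' where "h' = case_nat i0 h"
  have "h' j < h' (Suc j)" if "j < Suc n" for j
    using that h[of j] h[of "j - 1"] i0 unfolding h'_def
    by (cases j) (auto simp: e_def)
  moreover have "0 < - \<sigma> * (-1) ^ j * coeff ?q (h' j)" if "j \<le> Suc n" for j
    using that h[of "j - 1"] i0(2) unfolding h'_def
    by (cases j) (auto simp del: mult_pCons_left)
  ultimately show ?thesis unfolding alternates_def by blast
qed

lemma alternates_linear_minus_power_mult:
  "alternates p n \<Longrightarrow> r > 0 \<Longrightarrow> alternates ([:- r, 1:] ^ m * p) (m + n)"
  by (induction m) (auto intro: alternates_linear_minus_mult simp: mult.assoc simp del: mult_pCons_left)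

text \<open>Each factor \<open>X - r\<close> with \<open>r > 0\<close> contributes a sign change, so
  the roots are split off one point at a time; \<open>p\<close> varies because the cofactor replaces
  it.\<close>

lemma Descartes_alternates:
  assumes "finite S" "p \<noteq> 0" "\<And>r. r \<in> S \<Longrightarrow> r > 0"
  shows "alternates p (\<Sum>r\<in>S. order r p)"
  using assms
proof (induction arbitrary: p rule: finite_induct)
  case empty
  then show ?case by (simp add: alternates_0)
next
  case (insert r S)
  obtain q where q: "p = [:- r, 1:] ^ order r p * q"
    using order_1[of r p] by (elim dvdE)
  with insert.prems have "q \<noteq> 0" by auto
  have "order s p = order s q" if "s \<in> S" for s
  proof -
    have "order s ([:- r, 1:] ^ order r p) = 0"
      using that insert.hyps by (intro order_0I) auto
    then show ?thesis
      using insert.prems(1) q order_mult by (metis add_0)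
  qed
  moreover have "alternates q (\<Sum>s\<in>S. order s q)"
    using insert \<open>q \<noteq> 0\<close> by auto
  ultimately have "alternates ([:- r, 1:] ^ order r p * q) (order r p + (\<Sum>s\<in>S. order s p))"
    using insert.prems by (auto intro: alternates_linear_minus_power_mult)
  with q insert.hyps show ?case by simp
qed

section \<open>Transfer of roots along Moebius substitutions\<close>

lemma poly_eqI_pos:
  fixes p q :: "real poly"
  assumes "\<And>v. v > 0 \<Longrightarrow> poly p v = poly q v"
  shows "p = q"
proof (rule ccontr)
  assume "p \<noteq> q"
  then have "finite {v. poly (p - q) v = 0}"
    by (intro poly_roots_finite) simp
  then have "finite {0<..<1::real}"
    by (rule rev_finite_subset) (use assms in auto)
  then show False by (simp add: infinite_Ioo)
qed

text \<open>Clears denominators after substituting a fraction: the term of degree \<open>i\<close>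
  becomes \<open>L ^ i * M ^ (N - i)\<close>.\<close>

lemma homogenize_poly:
  fixes q L M :: "real poly"
  assumes "degree q \<le> N"
  obtains h where "\<And>v. poly M v \<noteq> 0 \<Longrightarrow> poly h v = poly M v ^ N * poly q (poly L v / poly M v)"
proof
  fix v
  assume M: "poly M v \<noteq> 0"
  have "poly q (poly L v / poly M v) = (\<Sum>i\<le>N. coeff q i * (poly L v / poly M v) ^ i)"
    unfolding poly_altdef using assms
    by (intro sum.mono_neutral_left) (auto simp: coeff_eq_0)
  also have "poly M v ^ N * \<dots> = poly (\<Sum>i\<le>N. smult (coeff q i) (L ^ i * M ^ (N - i))) v"
    using M by (auto simp: poly_sum sum_distrib_left power_divide power_diff intro!: sum.cong)
  finally show "poly (\<Sum>i\<le>N. smult (coeff q i) (L ^ i * M ^ (N - i))) v =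
      poly M v ^ N * poly q (poly L v / poly M v)" ..
qed

text \<open>
  The condition on \<open>r\<close> says that \<open>r = (p + q v) / (1 + s v)\<close> for some \<open>v > 0\<close>.
\<close>
lemma sum_order_Moebius_le:
  fixes g :: "real poly" and p q s :: real and d :: "'i \<Rightarrow> real" and A B :: "'i \<Rightarrow> nat"
  assumes "g \<noteq> 0" "degree g \<le> N" "finite I" "s \<ge> 0" "q \<noteq> p * s"
    and eq: "\<And>v. v > 0 \<Longrightarrow> (1 + s * v) ^ N * poly g ((p + q * v) / (1 + s * v)) =
        (\<Sum>i\<in>I. d i * v ^ A i * (1 + v) ^ B i)"
  shows "(\<Sum>r | poly g r = 0 \<and> (r - p) / (q - r * s) > 0. order r g) \<le> 2 * card I - 2"
proof -
  define S where "S = {r. poly g r = 0 \<and> (r - p) / (q - r * s) > 0}"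
  define w where "w r = (r - p) / (q - r * s)" for r
  define H where "H = (\<Sum>i\<in>I. monom (d i) (A i) * [:1, 1:] ^ B i)"
  have fin: "finite S"
    unfolding S_def using poly_roots_finite[OF assms(1)] by (rule rev_finite_subset) auto
  have wpos: "w r > 0" "q - r * s \<noteq> 0" if "r \<in> S" for r
    using that by (auto simp: S_def w_def)
  have inv: "r = (p + q * w r) / (1 + s * w r)" if "r \<in> S" for r
  proof -
    have "w r * (q - r * s) = r - p"
      using wpos[OF that] by (simp add: w_def)
    then have "r * (1 + s * w r) = p + q * w r"
      by (simp add: algebra_simps)
    moreover have "1 + s * w r > 0"
      using wpos[OF that] assms by (simp add: add_pos_nonneg)
    ultimately show ?thesis by (simp add: field_simps)
  qed
  then have inj: "inj_on w S"
    by (metis inj_onI)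
  have H: "poly H v = (1 + s * v) ^ N * poly g ((p + q * v) / (1 + s * v))" if "v > 0" for v
    using eq[OF that] by (simp add: H_def poly_sum poly_monom)
  \<comment> \<open>Otherwise \<open>g\<close> would vanish on the image of all
    \<open>v > 0\<close>, which is infinite because the determinant \<open>q - p * s\<close> is
    nonzero.\<close>
  have "H \<noteq> 0"
  proof
    assume "H = 0"
    have root: "poly g ((p + q * v) / (1 + s * v)) = 0" if "v > 0" for v
    proof -
      have "1 + s * v > 0" using that assms by (simp add: add_pos_nonneg)
      with H[OF that] \<open>H = 0\<close> show ?thesis by simp
    qed
    have "inj_on (\<lambda>v. (p + q * v) / (1 + s * v)) {0<..}"
    proof (rule inj_onI)
      fix u v
      assume *: "u \<in> {0<..}" "v \<in> {0<..}" "(p + q * u) / (1 + s * u) = (p + q * v) / (1 + s * v)"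
      have "1 + s * u > 0" "1 + s * v > 0"
        using * assms by (simp_all add: add_pos_nonneg)
      with *(3) have "(p + q * u) * (1 + s * v) = (p + q * v) * (1 + s * u)"
        by (simp add: frac_eq_eq)
      then have "(q - p * s) * (u - v) = 0"
        by (simp add: algebra_simps)
      with assms show "u = v" by simp
    qed
    moreover have "finite ((\<lambda>v. (p + q * v) / (1 + s * v)) ` {0<..})"
      using poly_roots_finite[OF assms(1)] by (rule rev_finite_subset) (use root in auto)
    ultimately have "finite {0::real<..}"
      by (simp add: finite_image_iff)
    then show False by (simp add: infinite_Ioi)
  qed
  \<comment> \<open>Of the \<open>N\<close> factors \<open>1 + s * v\<close>, \<open>?m\<close> turn
    \<open>(x - r) ^ ?m\<close> into a constant times \<open>(v - w r) ^ ?m\<close>; the other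
    \<open>N - ?m\<close> clear the cofactor.\<close>
  have ord: "order r g \<le> order (w r) H" if "r \<in> S" for r
  proof -
    let ?m = "order r g"
    let ?M = "[:1, s:]"
    obtain g' where g': "g = [:- r, 1:] ^ ?m * g'"
      using order_1[of r g] by (elim dvdE)
    with assms have "g' \<noteq> 0" by auto
    have "degree g = ?m + degree g'"
      using \<open>g' \<noteq> 0\<close> by (subst g') (simp add: degree_mult_eq degree_linear_power)
    with assms have deg: "degree g' \<le> N - ?m" "?m \<le> N" by auto
    obtain h where h: "\<And>v. poly ?M v \<noteq> 0 \<Longrightarrow>
        poly h v = poly ?M v ^ (N - ?m) * poly g' (poly [:p, q:] v / poly ?M v)"
      using homogenize_poly[OF deg(1)] by blast
    have "H = [:- w r, 1:] ^ ?m * smult ((q - r * s) ^ ?m) h"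
    proof (rule poly_eqI_pos)
      fix v :: real
      assume v: "v > 0"
      define x where "x = (p + q * v) / (1 + s * v)"
      have pos: "1 + s * v > 0"
        using v assms by (simp add: add_pos_nonneg)
      then have "(1 + s * v) * (x - r) = p + q * v - r * (1 + s * v)"
        by (simp add: x_def right_diff_distrib)
      also have "\<dots> = (q - r * s) * (v - w r)"
      proof -
        have "(q - r * s) * w r = r - p"
          using wpos[OF that] by (simp add: w_def)
        then show ?thesis by (simp add: algebra_simps)
      qed
      finally have *: "(1 + s * v) * (x - r) = (q - r * s) * (v - w r)" .
      have "poly H v = (1 + s * v) ^ (?m + (N - ?m)) * poly ([:- r, 1:] ^ ?m * g') x"
        using H[OF v] g' deg(2) by (simp add: x_def)
      also have "\<dots> = ((1 + s * v) * (x - r)) ^ ?m * ((1 + s * v) ^ (N - ?m) * poly g' x)"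
        by (simp add: power_add power_mult_distrib)
      also have "(1 + s * v) ^ (N - ?m) * poly g' x = poly h v"
        using h[of v] pos by (simp add: x_def mult.commute)
      finally show "poly H v = poly ([:- w r, 1:] ^ ?m * smult ((q - r * s) ^ ?m) h) v"
        unfolding * by (simp add: power_mult_distrib)
    qed
    then have "[:- w r, 1:] ^ ?m dvd H"
      by (rule dvdI)
    with \<open>H \<noteq> 0\<close> show ?thesis by (simp add: order_divides)
  qed
  have "(\<Sum>r\<in>S. order r g) \<le> (\<Sum>r\<in>S. order (w r) H)"
    by (rule sum_mono) (rule ord)
  also have "\<dots> = (\<Sum>v\<in>w ` S. order v H)"
    by (simp add: sum.reindex[OF inj])
  finally have le: "(\<Sum>r\<in>S. order r g) \<le> (\<Sum>v\<in>w ` S. order v H)" .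
  have "alternates H (\<Sum>v\<in>w ` S. order v H)"
    using fin wpos \<open>H \<noteq> 0\<close> by (intro Descartes_alternates) auto
  with le have "alternates H (\<Sum>r\<in>S. order r g)"
    by (rule alternates_mono[rotated])
  moreover have "\<not> alternates H (2 * card I - 1)"
    using alternates_lacunary[OF assms(3), of d A B] \<open>H \<noteq> 0\<close> by (auto simp: H_def)
  ultimately have "\<not> 2 * card I - 1 \<le> (\<Sum>r\<in>S. order r g)"
    using alternates_mono by blast
  then show ?thesis
    unfolding S_def by linarith
qed

section \<open>Assembling the count over the whole line\<close>

text \<open>Each root outside \<open>E\<close> is charged to every piece containing it, so overlaps
  do no harm; each root in \<open>E\<close> costs one.\<close>

lemma count_roots_except_le:
  assumes "g \<noteq> 0" "finite E" "finite K"
    and cover: "\<And>r. poly g r = 0 \<Longrightarrow> r \<notin> E \<Longrightarrow> \<exists>k\<in>K. P k r"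
    and le: "\<And>k. k \<in> K \<Longrightarrow> (\<Sum>r | poly g r = 0 \<and> P k r. order r g) \<le> m"
  shows "count_roots_except E g \<le> card K * m + card E"
proof -
  let ?Z = "{r. poly g r = 0}"
  have fin: "finite ?Z" using assms(1) by (rule poly_roots_finite)
  have "count_roots_except E g \<le>
      (\<Sum>r\<in>?Z. (\<Sum>k\<in>K. if P k r then order r g else 0) + (if r \<in> E then 1 else 0))"
    unfolding count_roots_except_def
  proof (rule sum_mono)
    fix r
    assume r: "r \<in> ?Z"
    show "(if r \<in> E then 1 else order r g) \<le>
        (\<Sum>k\<in>K. if P k r then order r g else 0) + (if r \<in> E then 1 else 0)"
    proof (cases "r \<in> E")
      case False
      with cover r obtain k where k: "k \<in> K" "P k r" by auto
      with assms(3) have "order r g \<le> (\<Sum>k\<in>K. if P k r then order r g else 0)"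
        using member_le_sum[of k K "\<lambda>k. if P k r then order r g else 0"] by simp
      with False show ?thesis by simp
    qed simp
  qed
  also have "\<dots> = (\<Sum>k\<in>K. \<Sum>r\<in>?Z. if P k r then order r g else 0) + card (?Z \<inter> E)"
    using fin by (simp add: sum.distrib sum.swap[of _ K] sum.If_cases Int_def)
  also have "(\<Sum>k\<in>K. \<Sum>r\<in>?Z. if P k r then order r g else 0) \<le> (\<Sum>k\<in>K. m)"
  proof (rule sum_mono)
    fix k
    assume "k \<in> K"
    with le[OF this] fin show "(\<Sum>r\<in>?Z. if P k r then order r g else 0) \<le> m"
      by (simp add: sum.If_cases Int_def)
  qed
  also have "card (?Z \<inter> E) \<le> card E"
    using assms(2) by (intro card_mono) auto
  finally show ?thesis by simp
qed

lemma count_roots_except_monomials: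
  fixes g :: "real poly" and d :: "'i \<Rightarrow> real" and A :: "'i \<Rightarrow> nat"
  assumes "g \<noteq> 0" "finite I" "\<And>x. poly g x = (\<Sum>i\<in>I. d i * x ^ A i)"
  shows "count_roots_except {0} g \<le> 2 * (2 * card I - 2) + 1"
proof -
  \<comment> \<open>The Moebius condition with \<open>p = s = 0\<close>, left unsimplified so that
    it matches; \<open>q\<close> selects a half-line.\<close>
  have "(\<Sum>r | poly g r = 0 \<and> (r - 0) / (q - r * 0) > 0. order r g) \<le> 2 * card I - 2"
    if "q \<in> {1, -1}" for q
  proof -
    have "q \<noteq> 0 * 0" using that by auto
    then show ?thesis
      by (rule sum_order_Moebius_le[where N = "degree g" and d = "\<lambda>i. d i * q ^ A i" and A = A
            and B = "\<lambda>_. 0", rotated 4])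
        (simp_all add: assms power_mult_distrib mult_ac)
  qed
  then have "count_roots_except {0} g \<le> card {1, -1 :: real} * (2 * card I - 2) + card {0 :: real}"
    by (intro count_roots_except_le[where P = "\<lambda>q r. (r - 0) / (q - r * 0) > 0"]) (use assms in auto)
  then show ?thesis by simp
qed

lemma count_roots_except_line:
  fixes g :: "real poly" and c :: "'i \<Rightarrow> real" and \<alpha> \<beta> :: "'i \<Rightarrow> nat" and a b :: real
  assumes "g \<noteq> 0" "finite I" "a \<noteq> 0" "b \<noteq> 0"
    and g: "\<And>x. poly g x = (\<Sum>i\<in>I. c i * x ^ \<alpha> i * (a * x + b) ^ \<beta> i)"
  shows "count_roots_except {0, - b / a} g \<le> 3 * (2 * card I - 2) + 2"
proof -
  define k where "k = b / a"
  have k: "k \<noteq> 0" "a * k = b" using assms by (auto simp: k_def)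
  \<comment> \<open>Large enough both to bound \<open>degree g\<close> and to keep the exponent
    \<open>N - (\<alpha> i + \<beta> i)\<close> of the third substitution free of
    truncation.\<close>
  define N where "N = degree g + (\<Sum>i\<in>I. \<alpha> i + \<beta> i)"
  have N: "\<alpha> i + \<beta> i \<le> N" if "i \<in> I" for i
    unfolding N_def using member_le_sum[of i I "\<lambda>i. \<alpha> i + \<beta> i"] that assms(2) by simp
  define P where "P = (\<lambda>(p, q, s) r. (r - p) / (q - r * s) > (0 :: real))"
  have 1: "(\<Sum>r | poly g r = 0 \<and> P (0, k, 0) r. order r g) \<le> 2 * card I - 2"
    unfolding P_def case_prod_conv
  proof (rule sum_order_Moebius_le[where N = N and A = \<alpha> and B = \<beta>
        and d = "\<lambda>i. c i * k ^ \<alpha> i * b ^ \<beta> i"])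
    fix v :: real
    have "a * (k * v) + b = b * (1 + v)"
      using k by (simp add: algebra_simps)
    then show "(1 + 0 * v) ^ N * poly g ((0 + k * v) / (1 + 0 * v)) =
        (\<Sum>i\<in>I. c i * k ^ \<alpha> i * b ^ \<beta> i * v ^ \<alpha> i * (1 + v) ^ \<beta> i)"
      by (simp add: g power_mult_distrib mult_ac)
  qed (use assms k in \<open>auto simp: N_def\<close>)
  \<comment> \<open>Here \<open>a * x + b\<close> becomes \<open>- b * v\<close>, so
    \<open>\<alpha>\<close> and \<open>\<beta>\<close> exchange roles.\<close>
  have 2: "(\<Sum>r | poly g r = 0 \<and> P (- k, - k, 0) r. order r g) \<le> 2 * card I - 2"
    unfolding P_def case_prod_conv
  proof (rule sum_order_Moebius_le[where N = N and A = \<beta> and B = \<alpha>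
        and d = "\<lambda>i. c i * (- k) ^ \<alpha> i * (- b) ^ \<beta> i"])
    fix v :: real
    have "- k + - k * v = - k * (1 + v)" "a * (- k * (1 + v)) + b = - b * v"
      using k by (simp_all add: algebra_simps)
    then show "(1 + 0 * v) ^ N * poly g ((- k + - k * v) / (1 + 0 * v)) =
        (\<Sum>i\<in>I. c i * (- k) ^ \<alpha> i * (- b) ^ \<beta> i * v ^ \<beta> i * (1 + v) ^ \<alpha> i)"
      by (simp only: g mult_zero_left add_0_right power_one mult_1_left div_by_1
          power_mult_distrib mult_ac)
  qed (use assms k in \<open>auto simp: N_def\<close>)
  \<comment> \<open>Here \<open>a * x + b\<close> becomes \<open>b / (1 + v)\<close>, so term
    \<open>i\<close> uses up \<open>\<alpha> i + \<beta> i\<close> of the \<open>N\<close> factors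
    \<open>1 + v\<close>.\<close>
  have 3: "(\<Sum>r | poly g r = 0 \<and> P (0, - k, 1) r. order r g) \<le> 2 * card I - 2"
    unfolding P_def case_prod_conv
  proof (rule sum_order_Moebius_le[where N = N and A = \<alpha> and B = "\<lambda>i. N - (\<alpha> i + \<beta> i)"
        and d = "\<lambda>i. c i * (- k) ^ \<alpha> i * b ^ \<beta> i"])
    fix v :: real
    assume v: "v > 0"
    have eq: "a * (- k * v / (1 + v)) + b = b / (1 + v)"
      using k v by (simp add: field_simps)
    have cancel: "(1 + v) ^ n * (y / (1 + v)) ^ n = y ^ n" for y :: real and n
      using v by (simp flip: power_mult_distrib)
    have "(1 + v) ^ N * (c i * (- k * v / (1 + v)) ^ \<alpha> i * (b / (1 + v)) ^ \<beta> i) =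
        c i * (- k) ^ \<alpha> i * b ^ \<beta> i * v ^ \<alpha> i * (1 + v) ^ (N - (\<alpha> i + \<beta> i))"
      if "i \<in> I" for i
    proof -
      have "(1 + v) ^ N = (1 + v) ^ (N - (\<alpha> i + \<beta> i)) * ((1 + v) ^ \<alpha> i * (1 + v) ^ \<beta> i)"
        using N[OF that] by (simp flip: power_add)
      then have "(1 + v) ^ N * (c i * (- k * v / (1 + v)) ^ \<alpha> i * (b / (1 + v)) ^ \<beta> i) =
          c i * ((1 + v) ^ \<alpha> i * (- k * v / (1 + v)) ^ \<alpha> i) *
          ((1 + v) ^ \<beta> i * (b / (1 + v)) ^ \<beta> i) * (1 + v) ^ (N - (\<alpha> i + \<beta> i))"
        by (simp only: mult_ac)
      then show ?thesis
        unfolding cancel by (simp only: power_mult_distrib mult_ac)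
    qed
    then show "(1 + 1 * v) ^ N * poly g ((0 + - k * v) / (1 + 1 * v)) =
        (\<Sum>i\<in>I. c i * (- k) ^ \<alpha> i * b ^ \<beta> i * v ^ \<alpha> i * (1 + v) ^ (N - (\<alpha> i + \<beta> i)))"
      unfolding g mult_1_left add_0_left eq sum_distrib_left by (rule sum.cong[OF refl])
  qed (use assms k in \<open>auto simp: N_def\<close>)
  let ?K = "{(0, k, 0), (- k, - k, 0), (0, - k, 1 :: real)}"
  have "count_roots_except {0, - k} g \<le> card ?K * (2 * card I - 2) + card {0, - k}"
  proof (rule count_roots_except_le[where P = P])
    fix r
    assume "r \<notin> {0, - k}"
    \<comment> \<open>For either sign of \<open>k\<close>, the three conditions describe the
      components of the line without \<open>0\<close> and \<open>- k\<close>.\<close>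
    then show "\<exists>z\<in>?K. P z r"
      using k(1) by (auto simp: P_def zero_less_divide_iff)
  qed (use assms 1 2 3 in auto)
  also have "\<dots> \<le> 3 * (2 * card I - 2) + 2"
    using k by (simp add: card_insert_if)
  finally show ?thesis by (simp add: k_def)
qed

theorem theorem1p1:
  fixes t :: nat and c :: "nat \<Rightarrow> real" and \<alpha> \<beta> :: "nat \<Rightarrow> nat"
    and f :: "real poly poly" and a b :: real and g :: "real poly"
  assumes "f = (\<Sum>i=1..t. bimonom (c i) (\<alpha> i) (\<beta> i))"
    and "g = restrict_line f a b"
  shows "g = 0 \<or> int (count_roots_except (exempt_points a b) g) \<le> 6 * int t - 4"
proof (cases "g = 0")
  case False
  have g: "poly g x = (\<Sum>i=1..t. c i * x ^ \<alpha> i * (a * x + b) ^ \<beta> i)" for x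
    unfolding assms restrict_line_def bimonom_def
    by (simp add: poly_sum poly_monom algebra_simps)
  \<comment> \<open>An empty sum gives \<open>g = 0\<close>. With \<open>t \<ge> 1\<close>, the
    natural and the integer value of \<open>6 * t - 4\<close> agree.\<close>
  have "t \<noteq> 0"
    using False assms by (intro notI) (simp add: restrict_line_def)
  have "count_roots_except (exempt_points a b) g \<le> 6 * t - 4"
  proof (cases "a = 0 \<or> b = 0")
    case True
    then have "\<exists>d A. \<forall>x. poly g x = (\<Sum>i=1..t. d i * x ^ A i)"
    proof
      assume "a = 0"
      then show ?thesis
        by (intro exI[of _ "\<lambda>i. c i * b ^ \<beta> i"] exI[of _ \<alpha>]) (simp add: g mult_ac)
    next
      assume "b = 0"
      then show ?thesis
        by (intro exI[of _ "\<lambda>i. c i * a ^ \<beta> i"] exI[of _ "\<lambda>i. \<alpha> i + \<beta> i"])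
          (simp add: g power_mult_distrib power_add mult_ac)
    qed
    \<comment> \<open>If \<open>b = 0\<close>, then \<open>- b / a\<close> coincides with
      \<open>0\<close>. The bound is \<open>4 * t - 3\<close>, at most \<open>6 * t - 4\<close> for
      \<open>t \<ge> 1\<close>.\<close>
    then have "count_roots_except {0} g \<le> 2 * (2 * card {1..t} - 2) + 1"
      using count_roots_except_monomials[OF False, of "{1..t}"] by blast
    with True \<open>t \<noteq> 0\<close> show ?thesis
      by (auto simp: exempt_points_def)
  next
    case False
    with count_roots_except_line[OF \<open>g \<noteq> 0\<close> _ _ _ g] \<open>t \<noteq> 0\<close> show ?thesis
      by (auto simp: exempt_points_def)
  qed
  with \<open>t \<noteq> 0\<close> show ?thesis by linarith
qed simp

end
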